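(* Let $F(X)$ be the free group on a finite set $X$ and let $K$ be a finitely generated subgroup of $F(X)$. (1) If $K\le H\le F(X)$ and $|H:K|<\infty$, then $K\le H$ is an algebraic extension. (2) If $K\le H$ and $H\le Q$ are algebraic extensions (with $H,Q\le F(X)$), then $K\le Q$ is an algebraic extension. (3) If $K\le H_1$ and $K\le H_2$ are algebraic extensions (with $H_1,H_2\le F(X)$), then $K\le H$ is also an algebraic extension, where $H=\langle H_1,H_2\rangle$.
   Context: Let $K \le H \le F(X)$. $H$ is a free extension of $K$ if there are subgroups $C \ne 1$ and $K'$ of $F(X)$ such that $K \le K'$ and $H = K' * C$ (internal free product). If $K \le H$ is not a free extension, it is called an algebraic extension. *)

theory Defs
  imports "HOL-Algebra.Generated_Groups"
begin

text \<open>The letter \<^term>\<open>(x, True)\<close> stands for the generator \<^term>\<open>x\<close>,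
  and \<^term>\<open>(x, False)\<close> for its formal inverse.\<close>

fun letter_inv :: "'a \<times> bool \<Rightarrow> 'a \<times> bool" where
  "letter_inv (x, b) = (x, \<not> b)"

definition reduced :: "('a \<times> bool) list \<Rightarrow> bool" where
  "reduced w \<longleftrightarrow> successively (\<lambda>u v. v \<noteq> letter_inv u) w"

fun push :: "'a \<times> bool \<Rightarrow> ('a \<times> bool) list \<Rightarrow> ('a \<times> bool) list" where
  "push u [] = [u]"
| "push u (v # w) = (if v = letter_inv u then w else u # v # w)"

text \<open>The free group \<open>F(S)\<close>, as the group of reduced words over \<^term>\<open>S\<close>. For a reduced word
  \<^term>\<open>w\<close>, the word \<^term>\<open>foldr push v w\<close> is the reduced form of \<^term>\<open>v @ w\<close>.\<close>

definition free_group :: "'a set \<Rightarrow> ('a \<times> bool) list monoid" where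
  "free_group S =
    \<lparr> carrier = {w. set w \<subseteq> S \<times> UNIV \<and> reduced w},
      monoid.mult = foldr push,
      monoid.one = [] \<rparr>"

lemma letter_inv_letter_inv [simp]: "letter_inv (letter_inv u) = u"
  by (cases u) simp

lemma reduced_Nil [simp]: "reduced []"
  by (simp add: reduced_def)

lemma reduced_Cons: "reduced (u # w) \<longleftrightarrow> (w = [] \<or> hd w \<noteq> letter_inv u) \<and> reduced w"
  by (cases w) (auto simp: reduced_def)

lemma reduced_push: "reduced w \<Longrightarrow> reduced (push u w)"
  by (cases w) (auto simp: reduced_Cons)

lemma reduced_foldr_push: "reduced w \<Longrightarrow> reduced (foldr push v w)"
  by (induction v) (auto intro: reduced_push)

lemma set_push: "set (push u w) \<subseteq> insert u (set w)"
  by (cases w) auto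

lemma set_foldr_push: "set (foldr push v w) \<subseteq> set v \<union> set w"
proof (induction v)
  case (Cons u v)
  then show ?case using set_push[of u "foldr push v w"] by auto
qed simp

lemma push_letter_inv: "reduced w \<Longrightarrow> push u (push (letter_inv u) w) = w"
  by (cases w; cases "tl w") (auto simp: reduced_Cons)

lemma foldr_push_push:
  "reduced w \<Longrightarrow> foldr push (push u v) w = push u (foldr push v w)"
  by (cases v) (auto simp: push_letter_inv reduced_foldr_push)

lemma foldr_push_assoc:
  "reduced w \<Longrightarrow> foldr push (foldr push u v) w = foldr push u (foldr push v w)"
  by (induction u) (auto simp: foldr_push_push)

lemma foldr_push_Nil: "reduced w \<Longrightarrow> foldr push w [] = w"
proof (induction w)
  case (Cons u w)
  then show ?case by (cases w) (auto simp: reduced_Cons)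
qed simp

lemma foldr_push_inverse: "foldr push (rev (map letter_inv w)) w = []"
  by (induction w) auto

lemma reduced_inverse: "reduced w \<Longrightarrow> reduced (rev (map letter_inv w))"
  unfolding reduced_def successively_rev successively_map
  by (erule successively_mono) auto

lemma group_free_group: "group (free_group S)"
proof (rule groupI)
  fix w assume "w \<in> carrier (free_group S)"
  then have "rev (map letter_inv w) \<in> carrier (free_group S)"
    by (auto simp: free_group_def reduced_inverse)
  then show "\<exists>v\<in>carrier (free_group S). v \<otimes>\<^bsub>free_group S\<^esub> w = \<one>\<^bsub>free_group S\<^esub>"
    by (rule bexI[rotated]) (simp add: free_group_def foldr_push_inverse)
next
  fix v w assume "v \<in> carrier (free_group S)" "w \<in> carrier (free_group S)"
  then show "v \<otimes>\<^bsub>free_group S\<^esub> w \<in> carrier (free_group S)"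
    using set_foldr_push[of v w] by (auto simp: free_group_def reduced_foldr_push)
qed (auto simp: free_group_def foldr_push_assoc)

text \<open>The elements of the free product \<open>A * B\<close>: alternating sequences of nontrivial elements
  of the two factors. The sum type keeps the factors apart, even where the sets \<^term>\<open>A\<close> and
  \<^term>\<open>B\<close> overlap.\<close>

definition free_product_words :: "('g, 'm) monoid_scheme \<Rightarrow> 'g set \<Rightarrow> 'g set \<Rightarrow> ('g + 'g) list set" where
  "free_product_words G A B =
    {w. set w \<subseteq> (A - {\<one>\<^bsub>G\<^esub>}) <+> (B - {\<one>\<^bsub>G\<^esub>}) \<and> successively (\<lambda>u v. isl u \<noteq> isl v) w}"

definition word_value :: "('g, 'm) monoid_scheme \<Rightarrow> ('g + 'g) list \<Rightarrow> 'g" where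
  "word_value G w = foldr (\<lambda>u g. case_sum id id u \<otimes>\<^bsub>G\<^esub> g) w \<one>\<^bsub>G\<^esub>"

text \<open>\<open>H\<close> is the internal free product \<open>A * B\<close> iff the canonical homomorphism from the free
  product \<open>A * B\<close>, which multiplies out alternating sequences, maps bijectively onto \<open>H\<close>.\<close>

definition internal_free_product ::
    "('g, 'm) monoid_scheme \<Rightarrow> 'g set \<Rightarrow> 'g set \<Rightarrow> 'g set \<Rightarrow> bool" where
  "internal_free_product G H A B \<longleftrightarrow>
    subgroup A G \<and> subgroup B G \<and> bij_betw (word_value G) (free_product_words G A B) H"

definition free_extension :: "('g, 'm) monoid_scheme \<Rightarrow> 'g set \<Rightarrow> 'g set \<Rightarrow> bool" where
  "free_extension G K H \<longleftrightarrow>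
    subgroup K G \<and> subgroup H G \<and> K \<subseteq> H \<and>
    (\<exists>C K'. subgroup C G \<and> subgroup K' G \<and> C \<noteq> {\<one>\<^bsub>G\<^esub>} \<and> K \<subseteq> K' \<and>
      internal_free_product G H K' C)"

definition algebraic_extension :: "('g, 'm) monoid_scheme \<Rightarrow> 'g set \<Rightarrow> 'g set \<Rightarrow> bool" where
  "algebraic_extension G K H \<longleftrightarrow>
    subgroup K G \<and> subgroup H G \<and> K \<subseteq> H \<and> \<not> free_extension G K H"

definition finitely_generated_subgroup :: "('g, 'm) monoid_scheme \<Rightarrow> 'g set \<Rightarrow> bool" where
  "finitely_generated_subgroup G K \<longleftrightarrow>
    (\<exists>Y. finite Y \<and> Y \<subseteq> carrier G \<and> K = generate G Y)"

definition finite_index :: "('g, 'm) monoid_scheme \<Rightarrow> 'g set \<Rightarrow> 'g set \<Rightarrow> bool" where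
  "finite_index G H K \<longleftrightarrow> finite (rcosets\<^bsub>G\<lparr>carrier := H\<rparr>\<^esub> K)"

end

theory Submission
  imports Defs
begin

text \<open>Everything rests on a weak form of the Kurosh subgroup theorem: if \<open>Q = A * B\<close> and
  \<open>H \<le> Q\<close>, then \<open>H \<inter> A\<close> is a free factor of \<open>H\<close>. Thus a subgroup \<open>H\<close> algebraic over \<open>K \<le> A\<close> lies
  in \<open>A\<close>, which gives (2) and (3) at once; (1) holds since \<open>F(X)\<close> is torsion-free.

  The complement of \<open>H \<inter> A\<close> comes from the Bass-Serre tree of \<open>A * B\<close>. For \<open>p \<in> Q\<close> let
  \<open>\<alpha> p \<in> A\<close> be the initial \<open>A\<close>-syllable of the normal form of \<open>p\<close>, i.e. the direction
  in which \<open>p\<close> is seen from the vertex \<open>A\<close>, and let \<open>F p = \<lambda> (\<alpha> p)\<close>, where \<open>\<lambda> : A \<rightarrow> H \<inter> A\<close>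
  is equivariant for left multiplication by \<open>H \<inter> A\<close> with \<open>\<lambda> 1 = 1\<close>. The complement consists of
  the \<open>h \<in> H\<close> that look like \<open>1\<close> from all translates of this vertex, i.e. \<open>F (g h) = F g\<close> for
  all \<open>g \<in> H\<close>.\<close>

section \<open>Internal free products\<close>

context group
begin

lemma word_value_closed:
  "set w \<subseteq> carrier G <+> carrier G \<Longrightarrow> word_value G w \<in> carrier G"
  by (induction w) (auto simp: word_value_def)

lemma word_value_snoc:
  assumes "set w \<subseteq> carrier G <+> carrier G" "x \<in> carrier G <+> carrier G"
  shows "word_value G (w @ [x]) = word_value G w \<otimes> case_sum id id x"
  using assms
proof (induction w)
  case (Cons y w)
  then show ?case
    using word_value_closed[of w] by (auto simp: word_value_def m_assoc)
qed (auto simp: word_value_def)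

lemma free_product_words_carrier:
  assumes "subgroup A G" "subgroup B G" "w \<in> free_product_words G A B"
  shows "set w \<subseteq> carrier G <+> carrier G"
  using assms subgroup.subset unfolding free_product_words_def by fastforce

lemma internal_free_product_factors:
  assumes "internal_free_product G Q A B"
  shows "A \<subseteq> Q" "B \<subseteq> Q"
proof -
  have sub: "subgroup A G" "subgroup B G"
    and Q: "Q = word_value G ` free_product_words G A B"
    using assms by (auto simp: internal_free_product_def bij_betw_def)
  have one: "\<one> \<in> Q"
    unfolding Q by (rule image_eqI[where x = "[]"]) (auto simp: word_value_def free_product_words_def)
  show "A \<subseteq> Q"
  proof
    fix a assume a: "a \<in> A"
    then have "a \<in> Q" if "a \<noteq> \<one>"
      unfolding Q using that subgroup.mem_carrier[OF sub(1) a]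
      by (intro image_eqI[where x = "[Inl a]"]) (auto simp: word_value_def free_product_words_def)
    with one show "a \<in> Q" by blast
  qed
  show "B \<subseteq> Q"
  proof
    fix b assume b: "b \<in> B"
    then have "b \<in> Q" if "b \<noteq> \<one>"
      unfolding Q using that subgroup.mem_carrier[OF sub(2) b]
      by (intro image_eqI[where x = "[Inr b]"]) (auto simp: word_value_def free_product_words_def)
    with one show "b \<in> Q" by blast
  qed
qed

text \<open>Words are peeled at the right end, because a right factor affects only the end of a
  normal form and so mostly preserves its initial syllable. The steps supply only
  \<open>p \<in> carrier G\<close>, so uses that need \<open>q \<in> Q\<close> put it into the
  predicate.\<close>

lemma internal_free_product_induct [consumes 2, case_names one left right]:
  assumes ifp: "internal_free_product G Q A B" and q: "q \<in> Q"
    and one: "P \<one>"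
    and left: "\<And>p a. p \<in> carrier G \<Longrightarrow> P p \<Longrightarrow> a \<in> A \<Longrightarrow> P (p \<otimes> a)"
    and right: "\<And>p b. p \<in> carrier G \<Longrightarrow> P p \<Longrightarrow> b \<in> B \<Longrightarrow> P (p \<otimes> b)"
  shows "P q"
proof -
  have sub: "subgroup A G" "subgroup B G"
    and Q: "Q = word_value G ` free_product_words G A B"
    using ifp by (auto simp: internal_free_product_def bij_betw_def)
  from q obtain w where w: "w \<in> free_product_words G A B" "q = word_value G w"
    unfolding Q by blast
  have "P (word_value G w)" if "set w \<subseteq> A <+> B" for w
    using that
  proof (induction w rule: rev_induct)
    case Nil
    show ?case using one by (simp add: word_value_def)
  next
    case (snoc x w)
    have *: "A \<subseteq> carrier G" "B \<subseteq> carrier G" using sub by (auto dest: subgroup.subset)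
    have sets: "set w \<subseteq> carrier G <+> carrier G" "x \<in> carrier G <+> carrier G"
      using snoc.prems * by fastforce+
    show ?case
      using snoc left[OF word_value_closed[OF sets(1)]] right[OF word_value_closed[OF sets(1)]]
      by (auto simp: word_value_snoc[OF sets])
  qed
  with w show ?thesis by (auto simp: free_product_words_def)
qed

text \<open>Only the last syllable reacts to a factor on the right: a nontrivial \<open>x\<close> is
  appended, merged with it, or cancels it. Hence the initial \<open>A\<close>-syllable
  \<open>fs\<close>, set to \<open>\<one>\<close> for words that are empty or start in
  \<open>B\<close>, can change only if \<open>x\<close> comes from \<open>A\<close> and
  \<open>w\<close> has no syllable beyond a first one from \<open>A\<close>.\<close>

lemma free_product_words_mult_right:
  assumes sub: "subgroup A G" "subgroup B G"
    and w: "w \<in> free_product_words G A B" and x: "x \<in> A <+> B"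
  defines "fs \<equiv> \<lambda>w. case w of Inl a # _ \<Rightarrow> a | _ \<Rightarrow> \<one>"
  shows "\<exists>w'\<in>free_product_words G A B. word_value G w' = word_value G w \<otimes> case_sum id id x
    \<and> (fs w' = fs w \<or> (isl x \<and> (w = [] \<or> (\<exists>a. w = [Inl a]))))"
proof -
  have carr: "A \<subseteq> carrier G" "B \<subseteq> carrier G" using sub by (auto dest: subgroup.subset)
  have wc: "set w \<subseteq> carrier G <+> carrier G" by (rule free_product_words_carrier[OF sub w])
  have xc: "x \<in> carrier G <+> carrier G" using x carr by auto
  show ?thesis
  proof (cases "case_sum id id x = \<one>")
    case True
    then show ?thesis using w word_value_closed[OF wc] by (intro bexI[of _ w]) auto
  next
    case nontriv: False
    show ?thesis
    proof (cases w rule: rev_cases)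
      case Nil
      have "[x] \<in> free_product_words G A B"
        using x nontriv by (auto simp: free_product_words_def)
      then show ?thesis using Nil xc x
        by (intro bexI[of _ "[x]"]) (auto simp: word_value_def fs_def)
    next
      case (snoc u z)
      show ?thesis
      proof (cases "isl z = isl x")
        case False
        have "w @ [x] \<in> free_product_words G A B"
          using x w nontriv snoc False
          by (auto simp: free_product_words_def successively_append_iff)
        moreover have "fs (w @ [x]) = fs w"
          by (cases u) (auto simp: fs_def snoc split: sum.splits)
        ultimately show ?thesis using word_value_snoc[OF wc xc] by blast
      next
        case True
        \<comment> \<open>The last syllable \<open>z\<close> and \<open>x\<close> come from the same
          factor: \<open>y\<close> is the merged syllable, which disappears and leaves
          \<open>u\<close> if its value is trivial.\<close>
        define y where "y = (if isl x then Inl else Inr) (case_sum id id z \<otimes> case_sum id id x)"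
        have zc: "z \<in> A <+> B" and uc: "set u \<subseteq> carrier G <+> carrier G"
          and uw: "u \<in> free_product_words G A B"
          using w wc snoc by (auto simp: free_product_words_def successively_append_iff)
        have zc': "z \<in> carrier G <+> carrier G" using wc snoc by auto
        have y: "y \<in> A <+> B" "isl y = isl x" "case_sum id id y = case_sum id id z \<otimes> case_sum id id x"
          using zc x True sub by (auto simp: y_def subgroup.m_closed split: if_splits)
        have yc: "y \<in> carrier G <+> carrier G" using y(1) carr by auto
        have "word_value G w \<otimes> case_sum id id x
            = word_value G u \<otimes> case_sum id id z \<otimes> case_sum id id x"
          using word_value_snoc[OF uc zc'] snoc by simp
        also have "\<dots> = word_value G u \<otimes> case_sum id id y"
          using word_value_closed[OF uc] zc' xc by (auto simp: y(3) m_assoc)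
        finally have val: "word_value G w \<otimes> case_sum id id x
            = word_value G u \<otimes> case_sum id id y" .
        have fs_w: "fs w' = fs w \<or> (isl x \<and> (w = [] \<or> (\<exists>a. w = [Inl a])))"
          if "w' = u \<or> w' = u @ [y]" for w'
        proof (cases u)
          case Nil
          then show ?thesis using that True y(2) snoc
            by (cases x; cases y; cases z) (auto simp: fs_def)
        next
          case (Cons v u')
          then show ?thesis using that snoc by (auto simp: fs_def)
        qed
        show ?thesis
        proof (cases "case_sum id id y = \<one>")
          case True
          then have "word_value G u = word_value G w \<otimes> case_sum id id x"
            using word_value_closed[OF uc] val by simp
          then show ?thesis using uw fs_w[of u] by blast
        next
          case False
          have "u @ [y] \<in> free_product_words G A B"
            using uw w y(1,2) snoc False \<open>isl z = isl x\<close>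
            by (auto simp: free_product_words_def successively_append_iff)
          moreover have "word_value G (u @ [y]) = word_value G w \<otimes> case_sum id id x"
            using word_value_snoc[OF uc yc] val by simp
          ultimately show ?thesis using fs_w[of "u @ [y]"] by blast
        qed
      qed
    qed
  qed
qed

text \<open>Normal forms are unique, so \<open>\<alpha>\<close> may read the first syllable off the
  word representing \<open>p\<close>, with value \<open>\<one>\<close> if it is missing or from
  \<open>B\<close>. The last property excludes \<open>p \<in> A\<close>, where a right factor from
  \<open>A\<close> is absorbed into the initial syllable.\<close>

lemma initial_syllable_exists:
  assumes ifp: "internal_free_product G Q A B"
  obtains \<alpha> where "\<And>a. a \<in> A \<Longrightarrow> \<alpha> a = a" "\<And>p. p \<in> Q \<Longrightarrow> \<alpha> p \<in> A"
    "\<And>p b. p \<in> Q \<Longrightarrow> b \<in> B \<Longrightarrow> \<alpha> (p \<otimes> b) = \<alpha> p"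
    "\<And>p a. p \<in> Q \<Longrightarrow> p \<notin> A \<Longrightarrow> a \<in> A \<Longrightarrow> \<alpha> (p \<otimes> a) = \<alpha> p"
proof -
  have sub: "subgroup A G" "subgroup B G"
    and inj: "inj_on (word_value G) (free_product_words G A B)"
    and Q: "Q = word_value G ` free_product_words G A B"
    using ifp by (auto simp: internal_free_product_def bij_betw_def)
  define fs where "fs w = (case w of Inl a # _ \<Rightarrow> a | _ \<Rightarrow> \<one>)" for w :: "('a + 'a) list"
  define \<alpha> where "\<alpha> p = fs (inv_into (free_product_words G A B) (word_value G) p)" for p
  have \<alpha>: "\<alpha> (word_value G w) = fs w" if "w \<in> free_product_words G A B" for w
    unfolding \<alpha>_def using inj that by simp
  have step: "\<alpha> (p \<otimes> case_sum id id x) = \<alpha> p"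
    if p: "p \<in> Q" and x: "x \<in> A <+> B" and px: "p \<in> A \<Longrightarrow> \<not> isl x" for p x
  proof -
    obtain w where w: "w \<in> free_product_words G A B" "p = word_value G w"
      using p unfolding Q by blast
    \<comment> \<open>The exceptional words of \<open>free_product_words_mult_right\<close> have
      values in \<open>A\<close>, and there \<open>px\<close> forbids a letter \<open>x\<close> from
      \<open>A\<close>.\<close>
    have "p \<in> A" if "w = [] \<or> (\<exists>a. w = [Inl a])"
      using that w sub by (auto simp: word_value_def free_product_words_def
          subgroup.one_closed subgroup.mem_carrier)
    then have "\<not> (isl x \<and> (w = [] \<or> (\<exists>a. w = [Inl a])))" using px by blast
    then obtain w' where "w' \<in> free_product_words G A B" "fs w' = fs w"
      "word_value G w' = word_value G w \<otimes> case_sum id id x"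
      using free_product_words_mult_right[OF sub w(1) x] unfolding fs_def by blast
    then show ?thesis using w \<alpha> by metis
  qed
  show thesis
  proof
    fix a assume a: "a \<in> A"
    show "\<alpha> a = a"
    proof (cases "a = \<one>")
      case True
      then show ?thesis
        using \<alpha>[of "[]"] by (simp add: word_value_def fs_def free_product_words_def)
    next
      case False
      then show ?thesis
        using \<alpha>[of "[Inl a]"] a subgroup.mem_carrier[OF sub(1) a]
        by (auto simp: word_value_def fs_def free_product_words_def)
    qed
  next
    fix p assume "p \<in> Q"
    then obtain w where "w \<in> free_product_words G A B" "p = word_value G w"
      unfolding Q by blast
    then show "\<alpha> p \<in> A"
      using \<alpha> sub
      by (auto simp: fs_def free_product_words_def subgroup.one_closed split: list.splits sum.splits)
  next
    fix p b assume "p \<in> Q" "b \<in> B"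
    then show "\<alpha> (p \<otimes> b) = \<alpha> p" using step[of p "Inr b"] by auto
  next
    fix p a assume "p \<in> Q" "p \<notin> A" "a \<in> A"
    then show "\<alpha> (p \<otimes> a) = \<alpha> p" using step[of p "Inl a"] by auto
  qed
qed

text \<open>A variant of the ping-pong lemma; on the free product, \<open>F\<close> is the initial \<open>A\<close>-syllable.\<close>

lemma internal_free_productI:
  assumes H: "subgroup H G" and A: "subgroup A G" and B: "subgroup B G"
    and AB: "A \<subseteq> H" "B \<subseteq> H" and gen: "H \<subseteq> generate G (A \<union> B)"
    and FA: "\<And>a q. a \<in> A \<Longrightarrow> q \<in> H \<Longrightarrow> F (a \<otimes> q) = a \<otimes> F q"
    and FB: "\<And>b. b \<in> B \<Longrightarrow> F b = \<one>"
    and FBq: "\<And>b q. b \<in> B \<Longrightarrow> b \<noteq> \<one> \<Longrightarrow> q \<in> H \<Longrightarrow> F q \<noteq> \<one> \<Longrightarrow> F (b \<otimes> q) = \<one>"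
  shows "internal_free_product G H A B"
proof -
  let ?W = "free_product_words G A B" and ?val = "word_value G"
  have carr: "A \<subseteq> carrier G" "B \<subseteq> carrier G" "H \<subseteq> carrier G"
    using A B H by (auto dest: subgroup.subset)
  have tl: "w \<in> ?W" if "x # w \<in> ?W" for x w
    using that by (cases w) (auto simp: free_product_words_def)
  have val_in: "?val w \<in> H" if "w \<in> ?W" for w
    using that
  proof (induction w)
    case Nil
    then show ?case using H by (simp add: word_value_def subgroup.one_closed)
  next
    case (Cons x w)
    have "case_sum id id x \<in> H" using Cons.prems AB by (auto simp: free_product_words_def)
    moreover have "?val w \<in> H" using Cons tl by blast
    ultimately show ?case using subgroup.m_closed[OF H] by (simp add: word_value_def)
  qed
  have valc: "?val w \<in> carrier G" if "w \<in> ?W" for w using val_in that carr by blast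
  \<comment> \<open>\<open>F\<close> reads off the leading \<open>A\<close>-syllable: behind a
    letter of \<open>A\<close> the tail has \<open>F\<close>-value \<open>\<one>\<close>, so
    \<open>FA\<close> yields that letter; behind a letter of \<open>B\<close> a nonempty tail has
    another \<open>F\<close>-value, so \<open>FBq\<close> applies.\<close>
  have F_val: "F (?val w) = (case w of Inl a # _ \<Rightarrow> a | _ \<Rightarrow> \<one>)" if "w \<in> ?W" for w
    using that
  proof (induction w)
    case Nil
    then show ?case using FB[of \<one>] B by (simp add: word_value_def subgroup.one_closed)
  next
    case (Cons x w)
    have w: "w \<in> ?W" using Cons tl by blast
    note IH = Cons.IH[OF w]
    show ?case
    proof (cases x)
      case (Inl a)
      have "F (?val w) = \<one>" using IH Cons.prems Inl
        by (cases w) (auto simp: free_product_words_def split: sum.splits)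
      moreover have "a \<in> A" using Cons.prems Inl by (auto simp: free_product_words_def)
      ultimately show ?thesis using FA[of a "?val w"] val_in[OF w] Inl carr
        by (auto simp: word_value_def)
    next
      case (Inr b)
      have b: "b \<in> B" "b \<noteq> \<one>" using Cons.prems Inr by (auto simp: free_product_words_def)
      show ?thesis
      proof (cases w)
        case Nil
        then show ?thesis using FB[of b] b Inr carr by (auto simp: word_value_def)
      next
        case (Cons y w')
        then have "F (?val w) \<noteq> \<one>" using IH \<open>x # w \<in> ?W\<close> Inr
          by (auto simp: free_product_words_def split: sum.splits)
        then show ?thesis using FBq[of b "?val w"] b val_in[OF w] Inr by (simp add: word_value_def)
      qed
    qed
  qed
  \<comment> \<open>If \<open>c\<close> were nontrivial, \<open>FB\<close> and \<open>FBq\<close>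
    would make \<open>F\<close> trivial at \<open>c \<otimes> ?val v = ?val w\<close>, so
    \<open>w\<close> would be empty. Then \<open>?val v = inv c\<close> would lie in
    \<open>B\<close>, so \<open>v\<close> would be empty too, and \<open>c = \<one>\<close>.\<close>
  have uniq: "b = b' \<and> ?val v = ?val w"
    if b: "b \<in> B" "b' \<in> B" and vw: "v \<in> ?W" "w \<in> ?W"
      and v: "v = [] \<or> F (?val v) \<noteq> \<one>" and w: "w = [] \<or> F (?val w) \<noteq> \<one>"
      and eq: "b \<otimes> ?val v = b' \<otimes> ?val w" for b b' v w
  proof -
    define c where "c = inv b' \<otimes> b"
    have bc: "b \<in> carrier G" "b' \<in> carrier G" using b carr by auto
    have c: "c \<in> B" "c \<in> carrier G" using b B bc by (auto simp: c_def subgroup.m_closed subgroup.m_inv_closed)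
    have ceq: "c \<otimes> ?val v = ?val w"
      using eq bc valc vw unfolding c_def by (metis inv_closed inv_solve_left m_assoc m_closed)
    have "c = \<one>"
    proof (rule ccontr)
      assume cn: "c \<noteq> \<one>"
      have "F (?val w) = \<one>"
        using v FBq[OF c(1) cn val_in[OF vw(1)]] FB[OF c(1)] c ceq by (auto simp: word_value_def)
      then have "?val w = \<one>" using w by (auto simp: word_value_def)
      then have "?val v = inv c" using ceq c valc[OF vw(1)] by (metis inv_equality inv_inv inv_closed)
      then have "F (?val v) = \<one>" using FB c B by (simp add: subgroup.m_inv_closed)
      then have "?val v = \<one>" using v by (auto simp: word_value_def)
      then show False using ceq cn \<open>?val w = \<one>\<close> c by simp
    qed
    then show ?thesis using ceq bc valc[OF vw(1)] unfolding c_def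
      by (metis inv_equality inv_inv inv_closed l_one)
  qed
  \<comment> \<open>Injectivity: a leading \<open>B\<close>-syllable is split off and compared by
    \<open>uniq\<close>; the rest is empty or starts in \<open>A\<close>, where \<open>F\<close>
    identifies the first syllable, which is then cancelled. A round may remove two letters, hence
    induction on the length.\<close>
  have "v = w" if "v \<in> ?W" "w \<in> ?W" "?val v = ?val w" for v w
    using that
  proof (induction v arbitrary: w rule: length_induct)
    case (1 v)
    \<comment> \<open>\<open>b = \<one>\<close> encodes a missing \<open>B\<close>-syllable, and
      \<open>F (?val u) \<noteq> \<one>\<close> says that \<open>u\<close> starts with a syllable
      from \<open>A\<close>.\<close>
    have decomp: "\<exists>b u. b \<in> B \<and> u \<in> ?W \<and> length u \<le> length x \<and> (u = [] \<or> F (?val u) \<noteq> \<one>)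
        \<and> ?val x = b \<otimes> ?val u \<and> x = (if b = \<one> then u else Inr b # u)" if x: "x \<in> ?W" for x
    proof (cases "\<exists>b u. x = Inr b # u")
      case True
      then obtain b u where bu: "x = Inr b # u" by blast
      have u: "u \<in> ?W" using tl x bu by blast
      have "u = [] \<or> F (?val u) \<noteq> \<one>" using F_val[OF u] x bu
        by (cases u) (auto simp: free_product_words_def split: sum.splits)
      then show ?thesis using x bu u
        by (intro exI[of _ b] exI[of _ u]) (auto simp: free_product_words_def word_value_def)
    next
      case False
      then have "x = [] \<or> F (?val x) \<noteq> \<one>" using F_val[OF x] x
        by (cases x) (auto simp: free_product_words_def split: sum.splits)
      then show ?thesis using x valc[OF x] B
        by (intro exI[of _ \<one>] exI[of _ x]) (auto simp: subgroup.one_closed)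
    qed
    obtain b v' where v': "b \<in> B" "v' \<in> ?W" "length v' \<le> length v" "v' = [] \<or> F (?val v') \<noteq> \<one>"
      "?val v = b \<otimes> ?val v'" "v = (if b = \<one> then v' else Inr b # v')"
      using decomp[OF 1(2)] by blast
    obtain b' w' where w': "b' \<in> B" "w' \<in> ?W" "w' = [] \<or> F (?val w') \<noteq> \<one>"
      "?val w = b' \<otimes> ?val w'" "w = (if b' = \<one> then w' else Inr b' # w')"
      using decomp[OF 1(3)] by blast
    have eq: "b = b'" "?val v' = ?val w'"
      using uniq[OF v'(1) w'(1) v'(2) w'(2) v'(4) w'(3)] v'(5) w'(4) 1(4) by auto
    have "v' = w'"
    proof (cases v')
      case Nil
      then have "F (?val w') = \<one>" using eq(2) F_val[of "[]"] v'(2) by simp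
      then show ?thesis using w'(3) Nil by auto
    next
      case (Cons x v'')
      then obtain a where a: "x = Inl a" "a \<noteq> \<one>"
        using F_val[OF v'(2)] v'(4) by (auto split: sum.splits)
      then have "F (?val v') = a" using F_val[OF v'(2)] Cons by simp
      then have "F (?val w') = a" using eq by simp
      then obtain w'' where w'': "w' = Inl a # w''"
        using F_val[OF w'(2)] a by (auto split: list.splits sum.splits)
      have tls: "v'' \<in> ?W" "w'' \<in> ?W" using tl v'(2) w'(2) Cons w'' by blast+
      have "a \<in> carrier G" using v'(2) Cons a carr by (auto simp: free_product_words_def)
      then have "?val v'' = ?val w''"
        using eq(2) Cons a w'' valc[OF tls(1)] valc[OF tls(2)] by (auto simp: word_value_def)
      moreover have "length v'' < length v" using v'(3) Cons by simp
      ultimately show ?thesis using 1(1) tls Cons a w'' by blast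
    qed
    then show ?case using eq v'(6) w'(5) by simp
  qed
  then have inj: "inj_on ?val ?W" by (auto intro: inj_onI)
  \<comment> \<open>Surjectivity: normal forms absorb a factor on the left by prepending it or by
    merging it with, or cancelling, the first syllable.\<close>
  have left_mult: "y \<otimes> ?val w \<in> ?val ` ?W" if y: "y \<in> A \<or> y \<in> B" and w: "w \<in> ?W" for y w
  proof -
    define lt where "lt = (if y \<in> A then Inl y else Inr y)"
    have lt: "lt \<in> A <+> B" "case_sum id id lt = y" using y by (auto simp: lt_def)
    have yc: "y \<in> carrier G" using y carr by auto
    show ?thesis
    proof (cases "y = \<one>")
      case True
      then show ?thesis using w valc by auto
    next
      case yn: False
      show ?thesis
      proof (cases "w = [] \<or> isl (hd w) \<noteq> isl lt")
        case True
        then have "lt # w \<in> ?W" using w lt yn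
          by (cases w) (auto simp: free_product_words_def)
        moreover have "?val (lt # w) = y \<otimes> ?val w" using lt(2) by (simp add: word_value_def)
        ultimately show ?thesis by (metis imageI)
      next
        case False
        then obtain z u where zu: "w = z # u" "isl z = isl lt" by (cases w) auto
        have u: "u \<in> ?W" using tl w zu by blast
        define m where "m = (if isl lt then Inl else Inr) (y \<otimes> case_sum id id z)"
        have z: "z \<in> A <+> B" using w zu by (auto simp: free_product_words_def)
        then have zc: "case_sum id id z \<in> carrier G" using carr by auto
        have m: "m \<in> A <+> B" "isl m = isl z" "case_sum id id m = y \<otimes> case_sum id id z"
          using lt z zu(2) A B by (auto simp: m_def subgroup.m_closed split: if_splits)
        have val: "y \<otimes> ?val w = case_sum id id m \<otimes> ?val u"
          using zu yc zc valc[OF u] by (simp add: word_value_def m(3) m_assoc)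
        show ?thesis
        proof (cases "case_sum id id m = \<one>")
          case True
          then show ?thesis using val valc[OF u] u by simp
        next
          case False
          then have "m # u \<in> ?W" using w zu m
            by (cases u) (auto simp: free_product_words_def)
          moreover have "?val (m # u) = y \<otimes> ?val w" using val by (simp add: word_value_def)
          ultimately show ?thesis by (metis imageI)
        qed
      qed
    qed
  qed
  have one: "\<one> \<in> ?val ` ?W"
    by (rule image_eqI[where x = "[]"]) (auto simp: word_value_def free_product_words_def)
  have gen_mult: "h \<otimes> q \<in> ?val ` ?W"
    if "h \<in> generate G (A \<union> B)" "q \<in> ?val ` ?W" for h q
    using that
  proof (induction arbitrary: q)
    case one
    then show ?case using valc by auto
  next
    case (incl h)
    then show ?case using left_mult by auto
  next
    case (inv h)
    then have "inv h \<in> A \<or> inv h \<in> B" using A B by (auto intro: subgroup.m_inv_closed)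
    then show ?case using left_mult inv by auto
  next
    case (eng h1 h2)
    have "h1 \<in> carrier G" "h2 \<in> carrier G"
      using eng generate_in_carrier[of "A \<union> B"] carr by auto
    moreover have "q \<in> carrier G" using eng.prems valc by auto
    ultimately show ?case using eng.IH(1)[OF eng.IH(2)[OF eng.prems]] by (simp add: m_assoc)
  qed
  have "H \<subseteq> ?val ` ?W"
  proof
    fix h assume h: "h \<in> H"
    then have "h \<otimes> \<one> \<in> ?val ` ?W" using gen by (intro gen_mult one) blast
    then show "h \<in> ?val ` ?W" using h carr by auto
  qed
  with val_in have "?val ` ?W = H" by auto
  with inj show ?thesis using A B by (simp add: internal_free_product_def bij_betw_def)
qed

section \<open>Intersections with a free factor\<close>

text \<open>Every \<open>a\<close> is factored as \<open>l a\<close> times the chosen representative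
  \<open>r (A' #> a)\<close> of its right coset. Left multiplication by \<open>A'\<close> keeps the
  coset and so moves only the first factor.\<close>

lemma equivariant_retraction_exists:
  assumes A: "subgroup A G" and A': "subgroup A' G" "A' \<subseteq> A"
  obtains l where "\<And>a. a \<in> A \<Longrightarrow> l a \<in> A'" "l \<one> = \<one>"
    "\<And>s a. s \<in> A' \<Longrightarrow> a \<in> A \<Longrightarrow> l (s \<otimes> a) = s \<otimes> l a"
proof -
  \<comment> \<open>The coset \<open>A'\<close> itself gets the representative
    \<open>\<one>\<close>, which ensures \<open>l \<one> = \<one>\<close>.\<close>
  define r where "r C = (if C = A' then \<one> else SOME x. x \<in> C)" for C
  define l where "l a = a \<otimes> inv (r (A' #> a))" for a
  have carr: "A \<subseteq> carrier G" "A' \<subseteq> carrier G" using A A' by (auto dest: subgroup.subset)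
  have r: "r (A' #> a) \<in> A' #> a" if "a \<in> A" for a
  proof (cases "A' #> a = A'")
    case True
    then show ?thesis using A' by (simp add: r_def subgroup.one_closed)
  next
    case False
    have "a \<in> A' #> a" using that carr A' by (intro rcos_self) auto
    then show ?thesis using False by (auto simp: r_def intro: someI)
  qed
  show thesis
  proof
    fix a assume a: "a \<in> A"
    obtain s where s: "s \<in> A'" "r (A' #> a) = s \<otimes> a" using r[OF a] by (auto simp: r_coset_def)
    have "s \<in> carrier G" "a \<in> carrier G" using s a carr by auto
    then have "l a = inv s" by (simp add: l_def s inv_mult_group m_assoc[symmetric])
    then show "l a \<in> A'" using s A' by (simp add: subgroup.m_inv_closed)
  next
    show "l \<one> = \<one>" using carr by (simp add: l_def r_def coset_mult_one)
  next
    fix s a assume sa: "s \<in> A'" "a \<in> A"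
    have c: "s \<in> carrier G" "a \<in> carrier G" using sa carr by auto
    have coset: "A' #> (s \<otimes> a) = A' #> a"
      using coset_mult_assoc[OF carr(2) c] coset_join2[OF c(1) A'(1) sa(1)] by simp
    have "r (A' #> a) \<in> carrier G"
      using r[OF sa(2)] r_coset_subset_G[OF carr(2) c(2)] by blast
    then show "l (s \<otimes> a) = s \<otimes> l a" using c by (simp add: l_def coset m_assoc)
  qed
qed

theorem Int_free_factor:
  assumes Q: "subgroup Q G" and ifp: "internal_free_product G Q A B"
    and H: "subgroup H G" and HQ: "H \<subseteq> Q"
  obtains D where "internal_free_product G H (H \<inter> A) D"
proof -
  have A: "subgroup A G" and B: "subgroup B G"
    using ifp by (auto simp: internal_free_product_def)
  have AQ: "A \<subseteq> Q" "B \<subseteq> Q" using internal_free_product_factors[OF ifp] .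
  have QG: "Q \<subseteq> carrier G" using Q by (rule subgroup.subset)
  have Qc: "\<And>x. x \<in> Q \<Longrightarrow> x \<in> carrier G" and Ac: "\<And>x. x \<in> A \<Longrightarrow> x \<in> carrier G"
    and Hc: "\<And>x. x \<in> H \<Longrightarrow> x \<in> carrier G" using QG AQ HQ by auto
  note Qm = subgroup.m_closed[OF Q] and Qi = subgroup.m_inv_closed[OF Q]
  note Am = subgroup.m_closed[OF A] and Ai = subgroup.m_inv_closed[OF A]
  note Hm = subgroup.m_closed[OF H] and Hi = subgroup.m_inv_closed[OF H]
  obtain \<alpha> where \<alpha>A: "\<And>a. a \<in> A \<Longrightarrow> \<alpha> a = a" and \<alpha>_in: "\<And>p. p \<in> Q \<Longrightarrow> \<alpha> p \<in> A"
    and \<alpha>b: "\<And>p b. p \<in> Q \<Longrightarrow> b \<in> B \<Longrightarrow> \<alpha> (p \<otimes> b) = \<alpha> p"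
    and \<alpha>a: "\<And>p a. p \<in> Q \<Longrightarrow> p \<notin> A \<Longrightarrow> a \<in> A \<Longrightarrow> \<alpha> (p \<otimes> a) = \<alpha> p"
    using initial_syllable_exists[OF ifp] by blast
  define A' where "A' = H \<inter> A"
  have A': "subgroup A' G" unfolding A'_def using H A by (rule subgroups_Inter_pair)
  obtain l where l_in: "\<And>a. a \<in> A \<Longrightarrow> l a \<in> A'" and l1: "l \<one> = \<one>"
    and l_mult: "\<And>s a. s \<in> A' \<Longrightarrow> a \<in> A \<Longrightarrow> l (s \<otimes> a) = s \<otimes> l a"
    using equivariant_retraction_exists[OF A A'] unfolding A'_def by blast

  \<comment> \<open>Initial syllables under left multiplication\<close>
  have cancel_A: "x \<in> A" if "s \<in> A" "s \<otimes> x \<in> A" "x \<in> Q" for s x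
    using Am[OF Ai[OF that(1)] that(2)] that Qc Ac by (simp add: m_assoc[symmetric])
  \<comment> \<open>Left multiplication by \<open>s\<close> keeps points outside \<open>A\<close>
    outside, by \<open>cancel_A\<close>, so there a right factor from \<open>A\<close> changes
    neither initial syllable; inside \<open>A\<close> both sides are explicit.\<close>
  have \<alpha>_equiv: "q \<in> Q \<and> \<alpha> (s \<otimes> q) = s \<otimes> \<alpha> q" if s: "s \<in> A" and q: "q \<in> Q" for s q
    using ifp q
  proof (induction rule: internal_free_product_induct)
    case one
    then show ?case using s \<alpha>A[of s] \<alpha>A[of \<one>] A Q Ac by (simp add: subgroup.one_closed)
  next
    case (left p a)
    have sp: "s \<otimes> p \<in> Q" using s left Qm AQ by blast
    have as: "s \<otimes> (p \<otimes> a) = (s \<otimes> p) \<otimes> a" using s left Ac by (simp add: m_assoc)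
    have pa: "p \<otimes> a \<in> Q" using left Qm AQ by blast
    show ?case
    proof (cases "p \<in> A")
      case True
      then have "p \<otimes> a \<in> A" "s \<otimes> (p \<otimes> a) \<in> A" using left s Am by auto
      then show ?thesis using \<alpha>A pa by simp
    next
      case False
      then have "s \<otimes> p \<notin> A" using cancel_A[of s p] s left by blast
      then show ?thesis using left False \<alpha>a[of p a] \<alpha>a[of "s \<otimes> p" a] sp pa as by simp
    qed
  next
    case (right p b)
    have "s \<otimes> p \<in> Q" "p \<otimes> b \<in> Q" using s right Qm AQ by blast+
    moreover have "s \<otimes> (p \<otimes> b) = (s \<otimes> p) \<otimes> b" using s right Ac Qc AQ by (simp add: m_assoc subset_iff)
    ultimately show ?case using right \<alpha>b[of p b] \<alpha>b[of "s \<otimes> p" b] by simp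
  qed
  \<comment> \<open>In the tree: seen from the vertex dA, the point \<open>d \<otimes> q\<close> and
    the vertex A lie in the directions \<open>\<alpha> q\<close> and
    \<open>\<alpha> (inv d)\<close>, translated by \<open>d\<close>. If these differ, the path from
    A to \<open>d \<otimes> q\<close> passes through dA and so leaves A in the direction
    \<open>\<alpha> d\<close>.\<close>
  have \<alpha>_left: "q \<in> Q \<and> (\<alpha> q \<noteq> \<alpha> (inv d) \<longrightarrow> \<alpha> (d \<otimes> q) = \<alpha> d)" if d: "d \<in> Q" "d \<notin> A" and q: "q \<in> Q" for d q
    using ifp q
  proof (induction rule: internal_free_product_induct)
    case one
    then show ?case using d Qc Q by (simp add: subgroup.one_closed)
  next
    case (left p a)
    have dp: "d \<otimes> p \<in> Q" using d left Qm by blast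
    have as: "d \<otimes> (p \<otimes> a) = (d \<otimes> p) \<otimes> a" using d left Ac Qc by (simp add: m_assoc)
    have pa: "p \<otimes> a \<in> Q" using left Qm AQ by blast
    show ?case
    proof (cases "p \<in> A")
      case True
      then have "p \<otimes> a \<in> A" using left Am by auto
      then show ?thesis using \<alpha>a[of d "p \<otimes> a"] d pa by simp
    next
      case False
      \<comment> \<open>If \<open>d \<otimes> p\<close> is in \<open>A\<close>, then
        \<open>p\<close> and \<open>inv d\<close> differ by a right factor from \<open>A\<close>. As
        \<open>p\<close> is outside \<open>A\<close>, they share their initial syllable, which is
        the excluded case.\<close>
      have "\<alpha> (p \<otimes> a) = \<alpha> (inv d)" if "d \<otimes> p \<in> A"
      proof -
        have "inv d = p \<otimes> inv (d \<otimes> p)"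
          using d left Qc by (simp add: inv_mult_group m_assoc[symmetric])
        then show ?thesis using \<alpha>a[of p "inv (d \<otimes> p)"] \<alpha>a[of p a] False left Ai[OF that] by simp
      qed
      then have "d \<otimes> p \<notin> A" "\<alpha> p \<noteq> \<alpha> (inv d)" if "\<alpha> (p \<otimes> a) \<noteq> \<alpha> (inv d)"
        using that left False \<alpha>a[of p a] by auto
      then show ?thesis using left \<alpha>a[of "d \<otimes> p" a] dp pa as by metis
    qed
  next
    case (right p b)
    have "d \<otimes> p \<in> Q" "p \<otimes> b \<in> Q" using d right Qm AQ by blast+
    moreover have "d \<otimes> (p \<otimes> b) = (d \<otimes> p) \<otimes> b" using d right Qc AQ by (simp add: m_assoc subset_iff)
    ultimately show ?case using right \<alpha>b[of p b] \<alpha>b[of "d \<otimes> p" b] by simp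
  qed

  \<comment> \<open>The complement \<open>D\<close>\<close>
  define F where "F p = l (\<alpha> p)" for p
  have F_A: "F a = l a" if "a \<in> A" for a using \<alpha>A that by (simp add: F_def)
  have F1: "F \<one> = \<one>" using F_A[of \<one>] l1 A by (simp add: subgroup.one_closed)
  \<comment> \<open>\<open>sim\<close> compares how \<open>p\<close> and \<open>q\<close> look under
    all translations by \<open>H\<close>. It will be used at points of \<open>Q\<close>, not only of
    \<open>H\<close>, since generation is proved by a walk through \<open>Q\<close>.\<close>
  define sim where "sim p q \<longleftrightarrow> (\<forall>g\<in>H. F (g \<otimes> p) = F (g \<otimes> q))" for p q
  define D where "D = {h \<in> H. sim h \<one>}"
  have DF: "F (g \<otimes> d) = F g" if "g \<in> H" "d \<in> D" for g d
    using that Hc by (simp add: D_def sim_def)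
  have DH: "D \<subseteq> H" by (auto simp: D_def)
  have D: "subgroup D G"
  proof (rule subgroupI)
    show "D \<subseteq> carrier G" using DH Hc by auto
    show "D \<noteq> {}" using subgroup.one_closed[OF H] by (auto simp: D_def sim_def)
  next
    fix d assume d: "d \<in> D"
    have dH: "d \<in> H" using d DH by blast
    have "F (g \<otimes> inv d) = F (g \<otimes> \<one>)" if g: "g \<in> H" for g
    proof -
      have "F (g \<otimes> inv d) = F ((g \<otimes> inv d) \<otimes> d)" using DF[of "g \<otimes> inv d" d] g dH d Hm Hi by simp
      then show ?thesis using g dH Hc by (simp add: m_assoc)
    qed
    then show "inv d \<in> D" using dH Hi by (simp add: D_def sim_def)
  next
    fix d e assume d: "d \<in> D" and e: "e \<in> D"
    have "F (g \<otimes> (d \<otimes> e)) = F (g \<otimes> \<one>)" if g: "g \<in> H" for g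
    proof -
      have "F ((g \<otimes> d) \<otimes> e) = F g" using DF[of "g \<otimes> d" e] DF[of g d] d e g DH Hm by auto
      then show ?thesis using g d e DH Hc by (simp add: m_assoc subset_iff)
    qed
    then show "d \<otimes> e \<in> D" using d e DH Hm by (auto simp: D_def sim_def)
  qed
  \<comment> \<open>On \<open>H \<inter> A\<close> the map \<open>F\<close> is the identity, on
    \<open>D\<close> it is constantly \<open>\<one>\<close>.\<close>
  have D_A: "d = \<one>" if "d \<in> D" "d \<in> A" for d
  proof -
    have "d \<in> A'" using that DH by (auto simp: A'_def)
    then have "l d = d" using l_mult[of d \<one>] l1 A Ac that by (simp add: subgroup.one_closed)
    moreover have "l d = \<one>" using DF[of \<one> d] F_A[of d] F1 that H Ac by (simp add: subgroup.one_closed)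
    ultimately show ?thesis by simp
  qed
  \<comment> \<open>\<open>sim\<close> is invariant under left multiplication by \<open>H\<close>,
    so it may be translated by \<open>inv g\<close>.\<close>
  have sim_D: "inv g \<otimes> h \<in> D" if gh: "g \<in> H" "h \<in> H" and s: "sim h g" for g h
  proof -
    have "F (k \<otimes> (inv g \<otimes> h)) = F (k \<otimes> \<one>)" if k: "k \<in> H" for k
    proof -
      have "F ((k \<otimes> inv g) \<otimes> h) = F ((k \<otimes> inv g) \<otimes> g)"
        using s k gh Hm Hi by (simp add: sim_def)
      then show ?thesis using k gh Hc by (simp add: m_assoc)
    qed
    then show ?thesis using gh Hm Hi by (simp add: D_def sim_def)
  qed
  \<comment> \<open>The next three facts list right factors that \<open>sim\<close> cannot detect:
    any from \<open>B\<close>; any from \<open>A\<close> if no \<open>H\<close>-translate of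
    \<open>p\<close> meets \<open>A\<close>; and, at a point of \<open>H\<close>, a coset
    representative \<open>t\<close>, that is, \<open>l t = \<one>\<close>.\<close>
  have sim_b: "sim (p \<otimes> b) p" if "p \<in> Q" "b \<in> B" for p b
    unfolding sim_def
  proof
    fix g assume g: "g \<in> H"
    have "F ((g \<otimes> p) \<otimes> b) = F (g \<otimes> p)"
      using \<alpha>b[of "g \<otimes> p" b] that g HQ Qm by (auto simp: F_def)
    then show "F (g \<otimes> (p \<otimes> b)) = F (g \<otimes> p)" using that g Hc Qc AQ by (simp add: m_assoc subset_iff)
  qed
  have sim_a: "sim (p \<otimes> a) p" if "p \<in> Q" "a \<in> A" and pn: "\<And>h. h \<in> H \<Longrightarrow> h \<otimes> p \<notin> A" for p a
    unfolding sim_def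
  proof
    fix g assume g: "g \<in> H"
    have "F ((g \<otimes> p) \<otimes> a) = F (g \<otimes> p)"
      using \<alpha>a[of "g \<otimes> p" a] that g HQ Qm by (auto simp: F_def)
    then show "F (g \<otimes> (p \<otimes> a)) = F (g \<otimes> p)" using that g Hc Qc Ac by (simp add: m_assoc)
  qed
  have sim_t: "sim (h \<otimes> t) h" if "h \<in> H" "t \<in> A" "l t = \<one>" for h t
    unfolding sim_def
  proof
    fix g assume g: "g \<in> H"
    have gh: "g \<otimes> h \<in> H" using g that Hm by blast
    \<comment> \<open>Inside \<open>A\<close> the element \<open>g \<otimes> h\<close> belongs to
      \<open>A'\<close>, and equivariance of \<open>l\<close> absorbs \<open>t\<close>; outside
      \<open>A\<close> the factor \<open>t\<close> does not reach the initial syllable.\<close>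
    have "F ((g \<otimes> h) \<otimes> t) = F (g \<otimes> h)"
    proof (cases "g \<otimes> h \<in> A")
      case True
      then have A'gh: "g \<otimes> h \<in> A'" using gh by (simp add: A'_def)
      have "l ((g \<otimes> h) \<otimes> t) = l ((g \<otimes> h) \<otimes> \<one>)"
        using l_mult[OF A'gh] that l1 A by (simp add: subgroup.one_closed del: r_one)
      then show ?thesis using True F_A Am that Ac by simp
    next
      case False
      then show ?thesis using \<alpha>a[of "g \<otimes> h" t] gh HQ that by (auto simp: F_def)
    qed
    then show "F (g \<otimes> (h \<otimes> t)) = F (g \<otimes> h)" using that g Hc Ac by (simp add: m_assoc)
  qed
  have sim_sym: "sim q p" if "sim p q" for p q using that by (simp add: sim_def)
  have sim_trans: "sim p r" if "sim p q" "sim q r" for p q r using that by (simp add: sim_def)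

  \<comment> \<open>Generation of \<open>H\<close> by \<open>H \<inter> A\<close> and
    \<open>D\<close>\<close>
  define M where "M = generate G (A' \<union> D)"
  have subM: "A' \<union> D \<subseteq> H" using DH by (auto simp: A'_def)
  have MH: "M \<subseteq> H" unfolding M_def by (rule generate_subgroup_incl[OF subM H])
  have M: "subgroup M G" unfolding M_def using subM Hc by (intro generate_is_subgroup) auto
  have M_incl: "A' \<subseteq> M" "D \<subseteq> M" by (auto simp: M_def intro: generate.incl)
  have M_step: "h \<in> M" if "g \<in> M" "h \<in> H" "sim h g" for g h
  proof -
    have "inv g \<otimes> h \<in> M" using sim_D[of g h] that MH M_incl by blast
    then have "g \<otimes> (inv g \<otimes> h) \<in> M" using M that by (simp add: subgroup.m_closed)
    then show ?thesis using that Hc MH by (simp add: m_assoc[symmetric] subset_iff)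
  qed
  \<comment> \<open>Along a walk from \<open>\<one>\<close> through \<open>Q\<close> by right
    factors, the current point stays similar to some element of \<open>M\<close>. At points of
    \<open>H\<close>, \<open>M_step\<close> turns this into membership in \<open>M\<close>.\<close>
  have reach: "p \<in> Q \<and> (\<exists>g\<in>M. sim p g)" if "p \<in> Q" for p
    using ifp that
  proof (induction rule: internal_free_product_induct)
    case one
    show ?case using Q M by (auto simp: sim_def subgroup.one_closed)
  next
    case (left p a)
    then obtain g where g: "g \<in> M" "sim p g" by blast
    have pQ: "p \<in> Q" and pa: "p \<otimes> a \<in> Q" using left AQ Qm by blast+
    show ?case
    proof (cases "\<exists>h\<in>H. h \<otimes> p \<in> A")
      case False
      then have "sim (p \<otimes> a) g" using sim_a[of p a] pQ left g sim_trans by blast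
      then show ?thesis using pa g by blast
    next
      case True
      then obtain h where h: "h \<in> H" "h \<otimes> p \<in> A" by blast
      \<comment> \<open>\<open>k\<close> is the \<open>A'\<close>-part of \<open>c\<close> and
        \<open>t\<close> its coset representative.\<close>
      have split: "\<exists>k t. t \<in> A \<and> l t = \<one> \<and> k \<in> A' \<and> c = k \<otimes> t" if c: "c \<in> A" for c
      proof -
        let ?k = "l c"
        let ?t = "inv ?k \<otimes> c"
        have k: "?k \<in> A'" "inv ?k \<in> A'" "?k \<in> A" "inv ?k \<in> A"
          using l_in[OF c] Hi Ai by (auto simp: A'_def)
        then have "l ?t = \<one>" using l_mult[of "inv ?k" c] c Ac by simp
        moreover have "c = ?k \<otimes> ?t" using k c Ac by (simp add: m_assoc[symmetric])
        ultimately show ?thesis using k c Am by blast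
      qed
      obtain k t where kt: "t \<in> A" "l t = \<one>" "k \<in> A'" "h \<otimes> p = k \<otimes> t" using split[OF h(2)] by blast
      obtain k' t' where kt': "t' \<in> A" "l t' = \<one>" "k' \<in> A'" "(h \<otimes> p) \<otimes> a = k' \<otimes> t'"
        using split[OF Am[OF h(2) \<open>a \<in> A\<close>]] by blast
      have kH: "k \<in> H" "k' \<in> H" using kt kt' by (auto simp: A'_def)
      \<comment> \<open>\<open>x\<close> and \<open>x'\<close> are the points of \<open>H\<close>
        that \<open>p\<close> and \<open>p \<otimes> a\<close> resemble by \<open>sim_t\<close>.
        They differ by the right factor \<open>inv k \<otimes> k'\<close> from \<open>A'\<close>, so
        \<open>x \<in> M\<close> carries over to \<open>x'\<close>.\<close>
      define x where "x = inv h \<otimes> k"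
      define x' where "x' = inv h \<otimes> k'"
      have xH: "x \<in> H" "x' \<in> H" using h kH Hm Hi by (auto simp: x_def x'_def)
      have cs: "h \<in> carrier G" "k \<in> carrier G" "k' \<in> carrier G" "t \<in> carrier G" "t' \<in> carrier G"
        "p \<in> carrier G" "a \<in> carrier G"
        using h kH kt kt' Hc Ac left by auto
      have "x \<otimes> t = inv h \<otimes> (h \<otimes> p)" using cs kt(4) by (simp add: x_def m_assoc)
      then have p: "p = x \<otimes> t" using cs by (simp add: m_assoc[symmetric])
      have "x' \<otimes> t' = inv h \<otimes> (h \<otimes> (p \<otimes> a))" using cs kt'(4) by (simp add: x'_def m_assoc)
      then have p': "p \<otimes> a = x' \<otimes> t'" using cs by (simp add: m_assoc[symmetric])
      have "sim x g" using sim_t[OF xH(1) kt(1,2)] p g sim_sym sim_trans by blast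
      then have xM: "x \<in> M" using M_step g xH by blast
      have "k \<otimes> (inv k \<otimes> k') = k'" using cs by (simp add: m_assoc[symmetric])
      then have "x' = x \<otimes> (inv k \<otimes> k')" using cs by (simp add: x_def x'_def m_assoc)
      moreover have "inv k \<otimes> k' \<in> M"
        using kt kt' A' M_incl by (auto simp: subgroup.m_closed subgroup.m_inv_closed)
      ultimately have "x' \<in> M" using xM M by (simp add: subgroup.m_closed)
      moreover have "sim (p \<otimes> a) x'" using sim_t[OF xH(2) kt'(1,2)] p' by simp
      ultimately show ?thesis using pa by blast
    qed
  next
    case (right p b)
    then show ?case using sim_b[of p b] sim_trans Qm AQ by blast
  qed
  have HM: "H \<subseteq> M" using reach M_step HQ by blast

  \<comment> \<open>Ping-pong conditions for \<open>F\<close>\<close>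
  have "internal_free_product G H A' D"
  proof (rule internal_free_productI[where F = F])
    show "subgroup H G" "subgroup A' G" "subgroup D G" "A' \<subseteq> H" "D \<subseteq> H" "H \<subseteq> generate G (A' \<union> D)"
      using H A' D subM HM by (auto simp: M_def)
  next
    fix s q assume "s \<in> A'" "q \<in> H"
    then show "F (s \<otimes> q) = s \<otimes> F q"
      using \<alpha>_equiv[of s q] l_mult[of s "\<alpha> q"] \<alpha>_in[of q] HQ by (auto simp: F_def A'_def)
  next
    fix d assume "d \<in> D"
    then show "F d = \<one>" using DF[of \<one> d] F1 H Hc DH by (auto simp: subgroup.one_closed)
  next
    fix d q assume d: "d \<in> D" "d \<noteq> \<one>" and q: "q \<in> H" "F q \<noteq> \<one>"
    \<comment> \<open>As \<open>F (inv d) = \<one>\<close> and \<open>F q \<noteq> \<one>\<close>,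
      the elements \<open>q\<close> and \<open>inv d\<close> lie in different directions, and
      \<open>\<alpha>_left\<close> gives \<open>F (d \<otimes> q) = F d\<close>.\<close>
    have F_D: "F e = \<one>" if "e \<in> D" for e
      using DF[of \<one> e] F1 H Hc DH that by (auto simp: subgroup.one_closed)
    have "F (inv d) = \<one>" using F_D d D by (simp add: subgroup.m_inv_closed)
    then have "\<alpha> q \<noteq> \<alpha> (inv d)" using q(2) by (auto simp: F_def)
    moreover have "d \<notin> A" using D_A d by blast
    ultimately have "\<alpha> (d \<otimes> q) = \<alpha> d" using \<alpha>_left[of d q] d q DH HQ by blast
    then show "F (d \<otimes> q) = \<one>" using F_D[OF d(1)] by (simp add: F_def)
  qed
  then show thesis using that by (simp add: A'_def)
qed

section \<open>Algebraic extensions\<close>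

text \<open>\<open>Int_free_factor\<close> splits \<open>H\<close> into \<open>H \<inter> A\<close>,
  which contains \<open>K\<close>, and some \<open>D\<close>; a nontrivial \<open>D\<close> would
  make \<open>H\<close> a free extension of \<open>K\<close>.\<close>

lemma algebraic_extension_subset_factor:
  assumes alg: "algebraic_extension G K H" and Q: "subgroup Q G"
    and ifp: "internal_free_product G Q A B" and HQ: "H \<subseteq> Q" and KA: "K \<subseteq> A"
  shows "H \<subseteq> A"
proof -
  have KH: "subgroup K G" "subgroup H G" "K \<subseteq> H" "\<not> free_extension G K H"
    using alg by (auto simp: algebraic_extension_def)
  obtain D where D: "internal_free_product G H (H \<inter> A) D"
    using Int_free_factor[OF Q ifp KH(2) HQ] .
  have sub: "subgroup (H \<inter> A) G" "subgroup D G" using D by (auto simp: internal_free_product_def)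
  have "D = {\<one>}"
    using KH KA D sub unfolding free_extension_def by blast
  have "h \<in> H \<inter> A" if "h \<in> H" for h
    using D that
  proof (induction rule: internal_free_product_induct)
    case one
    then show ?case using subgroup.one_closed[OF sub(1)] by blast
  next
    case (left p a)
    then show ?case using subgroup.m_closed[OF sub(1)] by blast
  next
    case (right p b)
    then show ?case using \<open>D = {\<one>}\<close> by auto
  qed
  then show ?thesis by blast
qed

text \<open>A nontrivial common element would be the value of two different one-letter
  words.\<close>

lemma internal_free_product_Int:
  assumes ifp: "internal_free_product G Q A B"
  shows "A \<inter> B = {\<one>}"
proof -
  have sub: "subgroup A G" "subgroup B G"
    and inj: "inj_on (word_value G) (free_product_words G A B)"
    using ifp by (auto simp: internal_free_product_def bij_betw_def)
  have "x = \<one>" if x: "x \<in> A" "x \<in> B" for x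
  proof (rule ccontr)
    assume "x \<noteq> \<one>"
    then have "[Inl x] \<in> free_product_words G A B" "[Inr x] \<in> free_product_words G A B"
      using x by (auto simp: free_product_words_def)
    moreover have "word_value G [Inl x] = word_value G [Inr x]" by (simp add: word_value_def)
    ultimately show False using inj by (auto dest: inj_onD)
  qed
  then show ?thesis using sub by (auto simp: subgroup.one_closed)
qed

text \<open>A splitting of \<open>Q\<close> whose factor \<open>K'\<close> contains \<open>K\<close>
  forces \<open>H\<close> into \<open>K'\<close>, so the same splitting would make \<open>Q\<close>
  a free extension of \<open>H\<close>.\<close>

lemma algebraic_extension_trans:
  assumes KH: "algebraic_extension G K H" and HQ: "algebraic_extension G H Q"
  shows "algebraic_extension G K Q"
proof -
  have sub: "subgroup K G" "subgroup Q G" "subgroup H G" "K \<subseteq> H" "H \<subseteq> Q"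
    using KH HQ by (auto simp: algebraic_extension_def)
  have "\<not> free_extension G K Q"
  proof
    assume "free_extension G K Q"
    then obtain C K' where C: "subgroup C G" "subgroup K' G" "C \<noteq> {\<one>}" "K \<subseteq> K'"
      "internal_free_product G Q K' C" by (auto simp: free_extension_def)
    have "H \<subseteq> K'"
      by (rule algebraic_extension_subset_factor[OF KH sub(2) C(5) sub(5) C(4)])
    then have "free_extension G H Q" using C sub by (auto simp: free_extension_def)
    then show False using HQ by (simp add: algebraic_extension_def)
  qed
  then show ?thesis using sub by (auto simp: algebraic_extension_def)
qed

text \<open>Any free factor of the join that contains \<open>K\<close> contains \<open>H1\<close>
  and \<open>H2\<close>, hence everything. Its complement, which meets it trivially, is then
  trivial.\<close>

lemma algebraic_extension_join:
  assumes H1: "algebraic_extension G K H1" and H2: "algebraic_extension G K H2"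
  shows "algebraic_extension G K (generate G (H1 \<union> H2))"
proof -
  let ?H = "generate G (H1 \<union> H2)"
  have sub: "subgroup K G" "subgroup H1 G" "subgroup H2 G" "K \<subseteq> H1"
    using H1 H2 by (auto simp: algebraic_extension_def)
  have H: "subgroup ?H G"
    using sub by (intro generate_is_subgroup) (auto dest: subgroup.subset)
  have incl: "H1 \<subseteq> ?H" "H2 \<subseteq> ?H" by (auto intro: generate.incl)
  have "\<not> free_extension G K ?H"
  proof
    assume "free_extension G K ?H"
    then obtain C K' where C: "subgroup C G" "subgroup K' G" "C \<noteq> {\<one>}" "K \<subseteq> K'"
      "internal_free_product G ?H K' C" by (auto simp: free_extension_def)
    have "H1 \<union> H2 \<subseteq> K'"
      using algebraic_extension_subset_factor[OF H1 H C(5) incl(1) C(4)]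
        algebraic_extension_subset_factor[OF H2 H C(5) incl(2) C(4)] by blast
    then have "?H \<subseteq> K'" using C(2) by (rule generate_subgroup_incl)
    then have "C \<subseteq> K'" using internal_free_product_factors(2)[OF C(5)] by blast
    then show False using internal_free_product_Int[OF C(5)] C(3) by blast
  qed
  then show ?thesis using sub H incl by (auto simp: algebraic_extension_def)
qed

text \<open>Pigeonhole on the cosets of the powers of \<open>c\<close>: two exponents with the same
  coset have a difference that serves as \<open>n\<close>.\<close>

lemma finite_index_pow_mem:
  assumes H: "subgroup H G" and K: "subgroup K G" "K \<subseteq> H"
    and fin: "finite_index G H K" and c: "c \<in> H"
  obtains n :: nat where "n > 0" "c [^] n \<in> K"
proof -
  have cc: "c \<in> carrier G" using subgroup.mem_carrier[OF H c] .
  have powH: "c [^] n \<in> H" for n :: nat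
    using c H by (induction n) (auto simp: subgroup.one_closed subgroup.m_closed)
  have "range (\<lambda>n::nat. K #> c [^] n) \<subseteq> rcosets\<^bsub>G\<lparr>carrier := H\<rparr>\<^esub> K"
    using powH by (auto simp: RCOSETS_def r_coset_def)
  then have "\<not> inj (\<lambda>n::nat. K #> c [^] n)"
    using fin finite_subset finite_imageD infinite_UNIV_nat unfolding finite_index_def by blast
  then obtain i j :: nat where ij: "i < j" "K #> c [^] i = K #> c [^] j"
    unfolding inj_def by (metis linorder_neqE_nat)
  have "c [^] j \<in> K #> c [^] i"
    using rcos_self[of "c [^] j" K] K cc ij by simp
  then obtain k where k: "k \<in> K" "c [^] j = k \<otimes> c [^] i" by (auto simp: r_coset_def)
  have kc: "k \<in> carrier G" using subgroup.mem_carrier[OF K(1) k(1)] .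
  have "c [^] (j - i) \<otimes> c [^] i = c [^] j" using ij cc by (simp add: nat_pow_mult)
  then have "c [^] (j - i) = k" using k kc cc by (metis nat_pow_closed right_cancel)
  then show thesis using that[of "j - i"] k ij by simp
qed

text \<open>A nontrivial element of a free complement \<open>C\<close> would have a positive power
  in \<open>K\<close>, hence in both factors, hence trivial, against torsion-freeness.\<close>

lemma finite_index_algebraic_extension:
  assumes torsion_free: "\<And>x n. x \<in> carrier G \<Longrightarrow> n > (0::nat) \<Longrightarrow> x [^] n = \<one> \<Longrightarrow> x = \<one>"
    and H: "subgroup H G" and K: "subgroup K G" "K \<subseteq> H" and fin: "finite_index G H K"
  shows "algebraic_extension G K H"
proof -
  have "\<not> free_extension G K H"
  proof
    assume "free_extension G K H"
    then obtain C K' where C: "subgroup C G" "subgroup K' G" "C \<noteq> {\<one>}" "K \<subseteq> K'"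
      "internal_free_product G H K' C" by (auto simp: free_extension_def)
    obtain c where c: "c \<in> C" "c \<noteq> \<one>" using C(3) subgroup.one_closed[OF C(1)] by blast
    have "c \<in> H" using internal_free_product_factors(2)[OF C(5)] c by blast
    then obtain n :: nat where n: "n > 0" "c [^] n \<in> K" using finite_index_pow_mem[OF H K fin] by blast
    have "c [^] n \<in> C" using c C(1)
      by (induction n) (auto simp: subgroup.one_closed subgroup.m_closed)
    then have "c [^] n = \<one>" using internal_free_product_Int[OF C(5)] n C(4) by blast
    then show False using torsion_free n c subgroup.mem_carrier[OF C(1)] by blast
  qed
  then show ?thesis using H K by (auto simp: algebraic_extension_def)
qed

end

section \<open>Free groups are torsion-free\<close>

lemma foldr_push_reduced_append: "reduced (v @ w) \<Longrightarrow> foldr push v w = v @ w"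
proof (induction v)
  case (Cons u v)
  then have "foldr push v w = v @ w" by (simp add: reduced_Cons)
  then show ?case using Cons.prems by (cases "v @ w") (auto simp: reduced_Cons)
qed simp

lemma reduced_append:
  "reduced (v @ w) \<longleftrightarrow> reduced v \<and> reduced w \<and>
    (v = [] \<or> w = [] \<or> hd w \<noteq> letter_inv (last v))"
  by (auto simp: reduced_def successively_append_iff)

text \<open>Positive powers of a nonempty cyclically reduced word are its repetitions, hence
  nonempty. Any other nonempty word is a conjugate of a shorter one, whose corresponding power is
  also trivial.\<close>

lemma free_group_torsion_free:
  assumes "w \<in> carrier (free_group S)" "n > (0::nat)"
    and "w [^]\<^bsub>free_group S\<^esub> n = \<one>\<^bsub>free_group S\<^esub>"
  shows "w = \<one>\<^bsub>free_group S\<^esub>"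
  using assms(1,3)
proof (induction w rule: length_induct)
  case (1 w)
  let ?G = "free_group S"
  interpret G: group ?G by (rule group_free_group)
  have red: "reduced w" and setw: "set w \<subseteq> S \<times> UNIV" using 1(2) by (auto simp: free_group_def)
  show ?case
  proof (rule ccontr)
    assume "w \<noteq> \<one>\<^bsub>?G\<^esub>"
    then have wn: "w \<noteq> []" by (simp add: free_group_def)
    show False
    proof (cases "hd w = letter_inv (last w)")
      case False
      \<comment> \<open>No cancellation occurs where two copies of \<open>w\<close> meet; the clause
        on \<open>hd\<close> lets the induction inspect this joint.\<close>
      have pow: "w [^]\<^bsub>?G\<^esub> k = concat (replicate k w) \<and> reduced (concat (replicate k w))
          \<and> (k > 0 \<longrightarrow> hd (concat (replicate k w)) = hd w)" for k :: nat
      proof (induction k)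
        case 0
        then show ?case by (simp add: free_group_def)
      next
        case (Suc k)
        have r: "reduced (w @ concat (replicate k w))"
          using Suc red wn False by (cases k) (auto simp: reduced_append)
        have "w [^]\<^bsub>?G\<^esub> Suc k = w \<otimes>\<^bsub>?G\<^esub> (w [^]\<^bsub>?G\<^esub> k)" using 1(2) by (rule G.nat_pow_Suc2)
        also have "\<dots> = w @ concat (replicate k w)"
          using Suc foldr_push_reduced_append[OF r] by (simp add: free_group_def)
        finally show ?case using r wn by simp
      qed
      then show False using 1(3) wn assms(2) by (auto simp: free_group_def)
    next
      case True
      define x where "x = last w"
      obtain v where v: "w = letter_inv x # v @ [x]"
      proof (cases w)
        case (Cons y u)
        \<comment> \<open>A letter differs from its own inverse, so \<open>w\<close> has at least
          two letters.\<close>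
        have "u \<noteq> []" using True Cons by (cases "hd w") auto
        then show thesis using that[of "butlast u"] Cons True by (auto simp: x_def)
      qed (use wn in simp)
      have xS: "x \<in> S \<times> UNIV" "letter_inv x \<in> S \<times> UNIV" using v setw by auto
      then have c: "[x] \<in> carrier ?G" "[letter_inv x] \<in> carrier ?G" "v \<in> carrier ?G"
        using v red setw by (auto simp: free_group_def reduced_Cons reduced_append)
      have rv: "reduced (v @ [x])" using red v by (simp add: reduced_Cons)
      \<comment> \<open>With \<open>v\<close> empty, \<open>letter_inv x\<close> and
        \<open>x\<close> would be adjacent in \<open>w\<close>.\<close>
      have vn: "v \<noteq> []" using red v by (auto simp: reduced_Cons)
      have inv: "[letter_inv x] = inv\<^bsub>?G\<^esub> [x]"
        by (rule G.inv_equality[symmetric]) (use c in \<open>auto simp: free_group_def\<close>)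
      have "v \<otimes>\<^bsub>?G\<^esub> [x] = v @ [x]"
        using foldr_push_reduced_append[OF rv] by (simp add: free_group_def)
      moreover have "[letter_inv x] \<otimes>\<^bsub>?G\<^esub> (v @ [x]) = w"
        using foldr_push_reduced_append[of "[letter_inv x]" "v @ [x]"] red v
        by (simp add: free_group_def)
      ultimately have w: "w = inv\<^bsub>?G\<^esub> [x] \<otimes>\<^bsub>?G\<^esub> (v \<otimes>\<^bsub>?G\<^esub> [x])" by (simp add: inv)
      have conj: "w [^]\<^bsub>?G\<^esub> k = inv\<^bsub>?G\<^esub> [x] \<otimes>\<^bsub>?G\<^esub> (v [^]\<^bsub>?G\<^esub> k \<otimes>\<^bsub>?G\<^esub> [x])" for k :: nat
      proof (induction k)
        case 0
        then show ?case using c by simp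
      next
        case (Suc k)
        have "[x] \<otimes>\<^bsub>?G\<^esub> (inv\<^bsub>?G\<^esub> [x] \<otimes>\<^bsub>?G\<^esub> (v \<otimes>\<^bsub>?G\<^esub> [x])) = v \<otimes>\<^bsub>?G\<^esub> [x]"
          using c by (simp add: G.m_assoc[symmetric])
        then show ?case using c Suc by (simp add: w G.m_assoc)
      qed
      have "v [^]\<^bsub>?G\<^esub> n \<otimes>\<^bsub>?G\<^esub> [x] = [x] \<otimes>\<^bsub>?G\<^esub> w [^]\<^bsub>?G\<^esub> n"
        using c by (simp add: conj G.m_assoc[symmetric])
      then have "v [^]\<^bsub>?G\<^esub> n = \<one>\<^bsub>?G\<^esub>" using c 1(3) by simp
      then have "v = \<one>\<^bsub>?G\<^esub>" using 1(1) c v by simp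
      then show False using vn by (simp add: free_group_def)
    qed
  qed
qed

theorem theorem11p6:
  fixes S :: "'a set" and K :: "('a \<times> bool) list set"
  assumes "finite S"
    and "finitely_generated_subgroup (free_group S) K"
  shows "(\<forall>H. subgroup H (free_group S) \<and> K \<subseteq> H \<and> finite_index (free_group S) H K
              \<longrightarrow> algebraic_extension (free_group S) K H)
       \<and> (\<forall>H Q. algebraic_extension (free_group S) K H \<and> algebraic_extension (free_group S) H Q
              \<longrightarrow> algebraic_extension (free_group S) K Q)
       \<and> (\<forall>H1 H2. algebraic_extension (free_group S) K H1 \<and> algebraic_extension (free_group S) K H2
              \<longrightarrow> algebraic_extension (free_group S) K (generate (free_group S) (H1 \<union> H2)))"
proof -
  interpret G: group "free_group S" by (rule group_free_group)
  have K: "subgroup K (free_group S)"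
    using assms(2) G.generate_is_subgroup by (auto simp: finitely_generated_subgroup_def)
  have "algebraic_extension (free_group S) K H"
    if "subgroup H (free_group S)" "K \<subseteq> H" "finite_index (free_group S) H K" for H
    by (rule G.finite_index_algebraic_extension[OF _ that(1) K that(2,3)])
      (rule free_group_torsion_free)
  then show ?thesis
    using G.algebraic_extension_trans G.algebraic_extension_join by blast
qed

end
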